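(* For every finite group $G$, $\mathcal{H}(G)\subseteq\mathcal{Q}(G)$.
   Context: All groups are finite. For a group $G$, let $B=\operatorname{Perm}(G)$ be the group of all permutations of the set $G$, let $\lambda:G\to B$, $\lambda(g)(h)=gh$, be the left regular representation, and let $\operatorname{Hol}(G)=\operatorname{Norm}_B(\lambda(G))$. A subgroup of $B$ is regular if it acts transitively with trivial point stabilizers. Define $\mathcal{H}(G)=\{N\leq B\mid N\text{ regular},\ N\cong G,\ \operatorname{Norm}_B(N)=\operatorname{Hol}(G)\}$, $\mathcal{S}(G)=\{N\leq B \mid N\text{ regular},\ N\cong G,\ N\leq\operatorname{Hol}(G)\}$, $\mathcal{R}(G)=\{N\leq B\mid N\text{ regular},\ N\cong G,\ \lambda(G)\leq\operatorname{Norm}_B(N)\}$. A subgroup $N$ normalizes $M$ if $N\leq\operatorname{Norm}_B(M)$. Define $$\mathcal{Q}(G)=\bigcap_{N\in\mathcal{S}(G)\cap\mathcal{R}(G)}\{M\in\mathcal{S}(G)\cap\mathcal{R}(G)\mid N\text{ normalizes }M\}.$$ *)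

theory Defs
  imports "HOL-Algebra.Group_Action"
begin

text \<open>
  The group of all permutations of the underlying set of \<open>G\<close>. Following \<^const>\<open>BijGroup\<close>,
  a permutation is a bijection of \<open>carrier G\<close> that is \<^const>\<open>undefined\<close> elsewhere, and the
  product is composition of functions, the right factor acting first.
\<close>

abbreviation Perm :: "('a, 'b) monoid_scheme \<Rightarrow> ('a \<Rightarrow> 'a) monoid"
  where "Perm G \<equiv> BijGroup (carrier G)"

abbreviation subgrp :: "('c, 'd) monoid_scheme \<Rightarrow> 'c set \<Rightarrow> ('c, 'd) monoid_scheme"
  where "subgrp B N \<equiv> B\<lparr>carrier := N\<rparr>"

definition left_regular :: "('a, 'b) monoid_scheme \<Rightarrow> 'a \<Rightarrow> ('a \<Rightarrow> 'a)"
  where "left_regular G g = (\<lambda>h\<in>carrier G. g \<otimes>\<^bsub>G\<^esub> h)"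

definition Hol :: "('a, 'b) monoid_scheme \<Rightarrow> ('a \<Rightarrow> 'a) set"
  where "Hol G = normalizer (Perm G) (left_regular G ` carrier G)"

definition regular :: "('a, 'b) monoid_scheme \<Rightarrow> ('a \<Rightarrow> 'a) set \<Rightarrow> bool"
  where "regular G N \<longleftrightarrow>
    transitive_action (subgrp (Perm G) N) (carrier G) (\<lambda>f. f) \<and>
    (\<forall>x\<in>carrier G. stabilizer (subgrp (Perm G) N) (\<lambda>f. f) x = {\<one>\<^bsub>Perm G\<^esub>})"

definition normalizes :: "('a, 'b) monoid_scheme \<Rightarrow> ('a \<Rightarrow> 'a) set \<Rightarrow> ('a \<Rightarrow> 'a) set \<Rightarrow> bool"
  where "normalizes G N M \<longleftrightarrow> N \<subseteq> normalizer (Perm G) M"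

definition H_set :: "('a, 'b) monoid_scheme \<Rightarrow> ('a \<Rightarrow> 'a) set set"
  where "H_set G = {N. subgroup N (Perm G) \<and> regular G N \<and> subgrp (Perm G) N \<cong> G \<and>
    normalizer (Perm G) N = Hol G}"

definition S_set :: "('a, 'b) monoid_scheme \<Rightarrow> ('a \<Rightarrow> 'a) set set"
  where "S_set G = {N. subgroup N (Perm G) \<and> regular G N \<and> subgrp (Perm G) N \<cong> G \<and>
    N \<subseteq> Hol G}"

definition R_set :: "('a, 'b) monoid_scheme \<Rightarrow> ('a \<Rightarrow> 'a) set set"
  where "R_set G = {N. subgroup N (Perm G) \<and> regular G N \<and> subgrp (Perm G) N \<cong> G \<and>
    left_regular G ` carrier G \<subseteq> normalizer (Perm G) N}"

definition Q_set :: "('a, 'b) monoid_scheme \<Rightarrow> ('a \<Rightarrow> 'a) set set"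
  where "Q_set G = (\<Inter>N\<in>S_set G \<inter> R_set G. {M \<in> S_set G \<inter> R_set G. normalizes G N M})"

end

theory Submission
  imports Defs "HOL-Algebra.Zassenhaus"
begin

text \<open>For \<open>M\<close> in \<open>H_set G\<close> the normalizer of \<open>M\<close> is
  \<open>Hol G\<close>, itself the normalizer of the left regular image. Since a subgroup lies in
  its own normalizer (\<open>subgroup_subset_normalizer\<close>), both \<open>M\<close> and the left
  regular image lie in \<open>Hol G\<close>, which puts \<open>M\<close> in \<open>S_set G\<close>
  and \<open>R_set G\<close>. Every \<open>N\<close> in \<open>S_set G\<close> lies in
  \<open>Hol G\<close>, hence normalizes \<open>M\<close>.\<close>

lemma (in group) subgroup_subset_normalizer:
  assumes "subgroup H G"
  shows "H \<subseteq> normalizer G H"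
  using subgroup.subset[OF normal_imp_subgroup[OF subgroup_in_normalizer[OF assms]]] by simp

lemma (in group) left_regular_in_Bij:
  assumes "g \<in> carrier G"
  shows "left_regular G g \<in> Bij (carrier G)"
  using inj_on_cmult[OF assms] surj_const_mult[OF assms]
  by (simp add: left_regular_def Bij_def bij_betw_def)

text \<open>This is associativity; both sides are restricted to the carrier, so agreement there
  gives equality of functions.\<close>

lemma (in group) left_regular_hom: "left_regular G \<in> hom G (Perm G)"
proof (rule homI)
  fix x y assume xy: "x \<in> carrier G" "y \<in> carrier G"
  have "left_regular G (x \<otimes> y) = compose (carrier G) (left_regular G x) (left_regular G y)"
    using xy by (auto simp: left_regular_def compose_def m_assoc)
  then show "left_regular G (x \<otimes> y) = left_regular G x \<otimes>\<^bsub>Perm G\<^esub> left_regular G y"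
    using xy by (simp add: BijGroup_def left_regular_in_Bij)
qed (simp add: BijGroup_def left_regular_in_Bij)

text \<open>Needed so that the left regular image lies in its own normalizer,
  \<open>Hol G\<close>.\<close>

lemma (in group) left_regular_image_subgroup:
  "subgroup (left_regular G ` carrier G) (Perm G)"
  by (intro group_hom.img_is_subgroup group_hom.intro group_hom_axioms.intro
      is_group group_BijGroup left_regular_hom)

theorem lemma4p8:
  fixes G :: "('a, 'b) monoid_scheme"
  assumes "group G" and "finite (carrier G)"
  shows "H_set G \<subseteq> Q_set G"
proof
  interpret group G by fact
  interpret P: group "Perm G" by (rule group_BijGroup)
  fix M assume M: "M \<in> H_set G"
  then have norm_M: "normalizer (Perm G) M = Hol G" and "subgroup M (Perm G)"
    by (simp_all add: H_set_def)
  then have "M \<subseteq> Hol G"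
    using P.subgroup_subset_normalizer by blast
  moreover have "left_regular G ` carrier G \<subseteq> Hol G"
    unfolding Hol_def by (rule P.subgroup_subset_normalizer[OF left_regular_image_subgroup])
  \<comment> \<open>By \<open>norm_M\<close>, the condition of \<open>R_set\<close> on
    \<open>M\<close> becomes containment of the left regular image in \<open>Hol G\<close>.\<close>
  ultimately have "M \<in> S_set G \<inter> R_set G"
    using M norm_M by (simp add: H_set_def S_set_def R_set_def)
  then show "M \<in> Q_set G"
    \<comment> \<open>For each \<open>N\<close> in the intersection, \<open>norm_M\<close> turns
      "normalizes \<open>M\<close>" into \<open>N \<subseteq> Hol G\<close>, which is part of
      \<open>S_set_def\<close>.\<close>
    by (auto simp: Q_set_def normalizes_def norm_M S_set_def)
qed

end
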